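(* For every positive integer $n$, $\hat{r}_c(nK_2,C_3)=4n-1$.
   Context: All graphs are finite and simple. $nK_2$ denotes a matching with $n$ edges, and $C_3$ denotes the triangle. For graphs $G, G_1, G_2$, write $G\to(G_1,G_2)$ if for every colouring of the edges of $G$ with red and blue, $G$ contains either a red copy of $G_1$ (all edges red) or a blue copy of $G_2$ (all edges blue). The connected size Ramsey number $\hat{r}_c(G_1,G_2)$ is the minimum number of edges of a connected graph $G$ with $G\to(G_1,G_2)$. *)

theory Defs
  imports Main
begin

text \<open>A graph is a pair of a vertex set and a set of edges, each edge being the set of its two ends.\<close>

type_synonym 'a ugraph = "'a set \<times> 'a set set"

abbreviation vertices :: "'a ugraph \<Rightarrow> 'a set" where
  "vertices G \<equiv> fst G"

abbreviation edges :: "'a ugraph \<Rightarrow> 'a set set" where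
  "edges G \<equiv> snd G"

definition simple_graph :: "'a ugraph \<Rightarrow> bool" where
  "simple_graph G \<longleftrightarrow>
     finite (vertices G) \<and> (\<forall>e\<in>edges G. e \<subseteq> vertices G \<and> card e = 2)"

definition connected_graph :: "'a ugraph \<Rightarrow> bool" where
  "connected_graph G \<longleftrightarrow>
     vertices G \<noteq> {} \<and>
     (\<forall>u\<in>vertices G. \<forall>v\<in>vertices G. (u, v) \<in> {(x, y). {x, y} \<in> edges G}\<^sup>*)"

text \<open>A copy of \<open>H\<close> in \<open>G\<close> is a not necessarily induced subgraph of \<open>G\<close> isomorphic to \<open>H\<close>.\<close>

definition contains_copy :: "'a ugraph \<Rightarrow> 'b ugraph \<Rightarrow> bool" where
  "contains_copy G H \<longleftrightarrow>
     (\<exists>f. inj_on f (vertices H) \<and> f ` vertices H \<subseteq> vertices G \<and>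
          (\<forall>e\<in>edges H. f ` e \<in> edges G))"

datatype colour = Red | Blue

definition colour_class :: "'a ugraph \<Rightarrow> ('a set \<Rightarrow> colour) \<Rightarrow> colour \<Rightarrow> 'a ugraph" where
  "colour_class G c k = (vertices G, {e \<in> edges G. c e = k})"

definition arrows :: "'a ugraph \<Rightarrow> 'b ugraph \<Rightarrow> 'c ugraph \<Rightarrow> bool" where
  "arrows G G1 G2 \<longleftrightarrow>
     (\<forall>c. contains_copy (colour_class G c Red) G1 \<or> contains_copy (colour_class G c Blue) G2)"

text \<open>Every finite graph is isomorphic to one whose vertices are natural numbers, so it
  suffices to let the host graph range over those.\<close>

definition connected_size_ramsey :: "'b ugraph \<Rightarrow> 'c ugraph \<Rightarrow> nat" where
  "connected_size_ramsey G1 G2 =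
     (LEAST m. \<exists>G :: nat ugraph.
        simple_graph G \<and> connected_graph G \<and> arrows G G1 G2 \<and> card (edges G) = m)"

definition matching_graph :: "nat \<Rightarrow> nat ugraph" where
  "matching_graph n = ({0..<2 * n}, {{2 * i, 2 * i + 1} | i. i < n})"

definition triangle_graph :: "nat ugraph" where
  "triangle_graph = ({0, 1, 2}, {{0, 1}, {1, 2}, {0, 2}})"

end

theory Submission
  imports Defs
begin

text \<open>
  The bound \<open>4n - 1\<close> is attained by \<open>n\<close> disjoint triangles joined in a chain by \<open>n - 1\<close> edges.

  For the lower bound, let \<open>S\<close> be a set of vertices meeting every component of a graph with edge
  set \<open>E\<close>. One shows by induction on \<open>E\<close> that some \<open>F \<subseteq> E\<close> with matching number \<open>k\<close>, where
  \<open>4k \<le> |E| + |S|\<close>, meets all triangles; for connected graphs \<open>|S| = 1\<close>, and colouring \<open>F\<close> red proves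
  the claim. An edge in no triangle is deleted at the cost of at most one new element of \<open>S\<close>.
  If every edge is in a triangle, some vertices are deleted so that \<open>|E| + |S|\<close> drops by 4, while the
  triangles destroyed are met by a star or a triangle. Let \<open>u\<close> be a vertex farthest from \<open>S\<close>. If \<open>u\<close> has
  degree at least 4, delete \<open>u\<close>: then \<open>S\<close> still meets every component. If some vertex \<open>x\<close> has degree 3,
  it has a neighbour \<open>a\<close> adjacent to its other two neighbours, and one deletes either \<open>a\<close> (if its degree
  is at least 4) or both \<open>x\<close> and \<open>a\<close>. If \<open>u\<close> has degree 2 and a neighbour \<open>y\<close> of degree at least 4,
  delete \<open>u\<close> and \<open>y\<close>; otherwise the component of \<open>u\<close> is a triangle.
\<close>

section \<open>Reachability, dominating vertex sets and triangle covers\<close>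

text \<open>The same closure as in \<open>connected_graph\<close>, so connectedness transfers by
  unfolding. It is reflexive even at vertices that lie on no edge.\<close>

definition reach :: "'a set set \<Rightarrow> ('a \<times> 'a) set" where
  "reach E = {(x, y). {x, y} \<in> E}\<^sup>*"

text \<open>Only components containing an edge have to be met, and \<open>S\<close> may contain
  points off the edges, so vertices that a deletion isolates do no harm.\<close>

definition dominates :: "'a set \<Rightarrow> 'a set set \<Rightarrow> bool" where
  "dominates S E \<longleftrightarrow> finite S \<and> (\<forall>w\<in>\<Union>E. \<exists>s\<in>S. (s, w) \<in> reach E)"

definition nbrs :: "'a set set \<Rightarrow> 'a \<Rightarrow> 'a set" where
  "nbrs E v = {w. {v, w} \<in> E}"

definition triangle_free :: "'a set set \<Rightarrow> bool" where
  "triangle_free E \<longleftrightarrow> \<not> (\<exists>x y z. {x, y} \<in> E \<and> {y, z} \<in> E \<and> {x, z} \<in> E)"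

text \<open>For nonempty edges a pairwise disjoint \<open>M\<close> is a matching, so the last
  clause bounds the matching number of \<open>F\<close>, the set that is to be coloured red.\<close>

definition triangle_cover :: "nat \<Rightarrow> 'a set set \<Rightarrow> bool" where
  "triangle_cover k E \<longleftrightarrow> (\<exists>F\<subseteq>E. triangle_free (E - F) \<and>
     (\<forall>M\<subseteq>F. pairwise disjnt M \<longrightarrow> card M \<le> k))"

lemma reach_refl [simp]: "(x, x) \<in> reach E"
  by (simp add: reach_def)

lemma reach_edge: "{x, y} \<in> E \<Longrightarrow> (x, y) \<in> reach E"
  by (auto simp: reach_def)

lemma reach_trans: "(x, y) \<in> reach E \<Longrightarrow> (y, z) \<in> reach E \<Longrightarrow> (x, z) \<in> reach E"
  by (simp add: reach_def)

lemma reach_sym: "(x, y) \<in> reach E \<Longrightarrow> (y, x) \<in> reach E"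
proof -
  have "sym ({(x, y). {x, y} \<in> E}\<^sup>*)"
    by (intro sym_rtrancl) (auto simp: sym_def insert_commute)
  then show "(x, y) \<in> reach E \<Longrightarrow> (y, x) \<in> reach E"
    by (auto simp: reach_def sym_def)
qed

lemma nbrs_iff: "w \<in> nbrs E v \<longleftrightarrow> {v, w} \<in> E"
  by (simp add: nbrs_def)

text \<open>Follow the walk from \<open>s\<close> to \<open>w\<close>. After its last edge outside
  \<open>E'\<close> it stands at an end of a removed edge, which \<open>bd\<close> reaches from
  \<open>R\<close>; if there is no such edge, the whole walk lies in \<open>E'\<close> and
  \<open>base\<close> applies.\<close>

lemma reach_subgraph:
  assumes "(s, w) \<in> reach E" "w \<in> \<Union>E'"
    and base: "s \<in> \<Union>E' \<Longrightarrow> \<exists>r\<in>R. (r, s) \<in> reach E'"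
    and bd: "\<And>x. x \<in> \<Union>(E - E') \<Longrightarrow> x \<in> \<Union>E' \<Longrightarrow> \<exists>r\<in>R. (r, x) \<in> reach E'"
  shows "\<exists>r\<in>R. (r, w) \<in> reach E'"
  using assms(1,2) unfolding reach_def[of E]
proof (induction rule: rtrancl_induct)
  case base
  then show ?case using assms(3) by blast
next
  case (step y z)
  show ?case
  proof (cases "{y, z} \<in> E'")
    case True
    then obtain r where "r \<in> R" "(r, y) \<in> reach E'" using step.IH by blast
    then show ?thesis using True reach_edge reach_trans by metis
  next
    case False
    then have "z \<in> \<Union>(E - E')" using step by blast
    then show ?thesis using bd step.prems by blast
  qed
qed

text \<open>Some \<open>s \<in> S\<close> lies in the component of a deleted edge; the set \<open>T\<close> takes over its part.\<close>

lemma dominates_subgraph: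
  assumes dom: "dominates S E" and sub: "E' \<subset> E" and ne: "\<And>e. e \<in> E \<Longrightarrow> e \<noteq> {}"
    and T: "finite T"
    and bd: "\<And>x. x \<in> \<Union>(E - E') \<Longrightarrow> x \<in> \<Union>E' \<Longrightarrow> \<exists>t\<in>T. (t, x) \<in> reach E'"
  shows "\<exists>S'. dominates S' E' \<and> card S' + 1 \<le> card S + card T"
proof -
  obtain e x where ex: "e \<in> E" "e \<notin> E'" "x \<in> e" using sub ne by blast
  have S: "finite S" using dom by (simp add: dominates_def)
  obtain s where s: "s \<in> S" "(s, x) \<in> reach E"
    using dom ex unfolding dominates_def by blast
  define S' where "S' = (S - {s}) \<union> T"
  have "\<exists>r\<in>S'. (r, w) \<in> reach E'" if w: "w \<in> \<Union>E'" for w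
  proof -
    obtain s' where s': "s' \<in> S" "(s', w) \<in> reach E"
      using dom w sub unfolding dominates_def by blast
    show ?thesis
    proof (cases "s' = s")
      case True
      \<comment> \<open>The walk is restarted at \<open>x\<close>, which lies on a removed edge; so
        \<open>bd\<close> supplies the start of the walk as well as its later re-entries.\<close>
      then have xw: "(x, w) \<in> reach E" using s s' reach_sym reach_trans by metis
      show ?thesis
        by (rule reach_subgraph[OF xw w]) (use bd ex S'_def in blast)+
    next
      case False
      then have "s' \<in> S'" using s' by (simp add: S'_def)
      then have "\<exists>r\<in>S'. (r, s') \<in> reach E'" by (rule bexI[rotated]) simp
      then show ?thesis
        by (rule reach_subgraph[OF s'(2) w]) (use bd S'_def in blast)
    qed
  qed
  moreover have "card S' + 1 \<le> card S + card T"
  proof -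
    have "card S' \<le> card (S - {s}) + card T" unfolding S'_def by (rule card_Un_le)
    moreover have "card (S - {s}) + 1 = card S"
      using S s by (metis Suc_eq_plus1 card_Suc_Diff1)
    ultimately show ?thesis by linarith
  qed
  moreover have "finite S'" using S T by (simp add: S'_def)
  ultimately show ?thesis unfolding dominates_def by blast
qed

text \<open>A triangle avoiding \<open>A\<close> lies entirely in \<open>E'\<close> and is met there
  by \<open>F\<close>; a matching in \<open>F \<union> A\<close> splits into its parts in
  \<open>F\<close> and in \<open>A\<close>.\<close>

lemma triangle_cover_extend:
  assumes cov: "triangle_cover k E'" and sub: "E' \<subseteq> E" "A \<subseteq> E"
    and A: "\<And>M. M \<subseteq> A \<Longrightarrow> pairwise disjnt M \<Longrightarrow> card M \<le> j"
    and tri: "\<And>x y z. {x, y} \<in> E - A \<Longrightarrow> {y, z} \<in> E - A \<Longrightarrow> {x, z} \<in> E - A \<Longrightarrow> {x, y} \<in> E'"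
  shows "triangle_cover (k + j) E"
proof -
  obtain F where F: "F \<subseteq> E'" "triangle_free (E' - F)"
      "\<And>M. M \<subseteq> F \<Longrightarrow> pairwise disjnt M \<Longrightarrow> card M \<le> k"
    using cov unfolding triangle_cover_def by blast
  have False if a: "{x, y} \<in> E" "{y, z} \<in> E" "{x, z} \<in> E"
      "{x, y} \<notin> F \<union> A" "{y, z} \<notin> F \<union> A" "{x, z} \<notin> F \<union> A" for x y z
  proof -
    \<comment> \<open>\<open>tri\<close> speaks of one edge only; relabelling the triangle yields
      the other two.\<close>
    have "{x, y} \<in> E'" "{y, z} \<in> E'" "{x, z} \<in> E'"
      using tri[of x y z] tri[of y z x] tri[of x z y] a by (auto simp: insert_commute)
    then show False using F(2) a unfolding triangle_free_def by blast
  qed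
  then have "triangle_free (E - (F \<union> A))" unfolding triangle_free_def by blast
  moreover have "card M \<le> k + j" if M: "M \<subseteq> F \<union> A" "pairwise disjnt M" for M
  proof -
    have "card M \<le> card (M \<inter> F) + card (M \<inter> A)"
      using M(1) by (metis Int_Un_distrib card_Un_le inf.absorb1)
    also have "\<dots> \<le> k + j"
      using M(2) by (intro add_mono F(3) A) (auto intro: pairwise_subset)
    finally show ?thesis .
  qed
  ultimately show ?thesis
    unfolding triangle_cover_def using F(1) sub by (intro exI[of _ "F \<union> A"]) auto
qed

lemma card_intersecting_matching:
  assumes "\<And>e e'. e \<in> A \<Longrightarrow> e' \<in> A \<Longrightarrow> e \<inter> e' \<noteq> {}" "M \<subseteq> A" "pairwise disjnt M"
  shows "card M \<le> 1"
proof (cases "finite M")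
  case True
  have "e = e'" if "e \<in> M" "e' \<in> M" for e e'
    using assms that unfolding pairwise_def disjnt_def by blast
  then show ?thesis using True by (metis One_nat_def card_le_Suc0_iff_eq)
qed simp

section \<open>A vertex whose deletion keeps the set dominating\<close>

text \<open>Take \<open>u\<close> at maximal distance from \<open>S\<close>. A shortest walk from
  \<open>S\<close> to another vertex has length at most the distance of \<open>u\<close>, so it
  cannot pass through \<open>u\<close> and go on; it survives the deletion of
  \<open>u\<close>.\<close>

lemma distance_maximal_not_cut:
  assumes dom: "dominates S E" and fin: "finite (\<Union>E)" and ne: "\<Union>E \<noteq> {}"
  shows "\<exists>u\<in>\<Union>E. dominates S {e \<in> E. u \<notin> e}"
proof -
  define R where "R = {(x, y). {x, y} \<in> E}"
  define P where "P w n \<longleftrightarrow> (\<exists>s\<in>S. (s, w) \<in> R ^^ n)" for w n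
  define d where "d w = (LEAST n. P w n)" for w
  have P: "P w (d w)" if w: "w \<in> \<Union>E" for w
  proof -
    obtain s where "s \<in> S" "(s, w) \<in> R\<^sup>*"
      using dom w unfolding dominates_def reach_def R_def by blast
    then obtain n where "(s, w) \<in> R ^^ n" using rtrancl_imp_relpow by blast
    then have "P w n" using \<open>s \<in> S\<close> unfolding P_def by blast
    then show ?thesis unfolding d_def by (rule LeastI)
  qed
  have "Max (d ` \<Union>E) \<in> d ` \<Union>E" using fin ne by (intro Max_in) auto
  then obtain u where "u \<in> \<Union>E" "Max (d ` \<Union>E) = d u" by blast
  then have max: "d w \<le> d u" if "w \<in> \<Union>E" for w
    using Max_ge[of "d ` \<Union>E" "d w"] fin that by auto
  let ?E' = "{e \<in> E. u \<notin> e}"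
  have path: "(s, w) \<in> reach ?E'"
    if "(s, w) \<in> R ^^ n" "n \<le> d u" "w \<noteq> u" "s \<in> S" for s w n
    using that
  proof (induction n arbitrary: w)
    case 0
    then show ?case by simp
  next
    case (Suc n)
    then obtain v where v: "(s, v) \<in> R ^^ n" "{v, w} \<in> E" by (auto simp: R_def)
    have "v \<noteq> u"
    proof
      assume "v = u"
      then have "P u n" using v Suc.prems by (auto simp: P_def)
      then have "d u \<le> n" unfolding d_def by (rule Least_le)
      then show False using Suc.prems by simp
    qed
    then have "(s, v) \<in> reach ?E'" "{v, w} \<in> ?E'" using Suc v by auto
    then show ?case by (blast intro: reach_edge reach_trans)
  qed
  have "\<exists>s\<in>S. (s, w) \<in> reach ?E'" if "w \<in> \<Union>?E'" for w
  proof -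
    have w: "w \<in> \<Union>E" "w \<noteq> u" using that by auto
    obtain s where "s \<in> S" "(s, w) \<in> R ^^ d w" using P[OF w(1)] by (auto simp: P_def)
    then show ?thesis using path max[OF w(1)] w(2) by blast
  qed
  then have "dominates S ?E'" using dom unfolding dominates_def by blast
  then show ?thesis using \<open>u \<in> \<Union>E\<close> by blast
qed

section \<open>Counting the edges lost with deleted vertices\<close>

lemma star_eq_image:
  assumes "\<And>e. e \<in> E \<Longrightarrow> card e = 2"
  shows "{e \<in> E. v \<in> e} = (\<lambda>w. {v, w}) ` nbrs E v"
proof -
  have "\<exists>w. e = {v, w}" if "e \<in> E" "v \<in> e" for e
    using assms[OF that(1)] that(2) by (auto simp: card_2_iff)
  then show ?thesis by (auto simp: nbrs_def)
qed

lemma card_star: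
  assumes "\<And>e. e \<in> E \<Longrightarrow> card e = 2"
  shows "card {e \<in> E. v \<in> e} = card (nbrs E v)"
proof -
  have "inj_on (\<lambda>w. {v, w}) (nbrs E v)" by (auto simp: inj_on_def doubleton_eq_iff)
  then show ?thesis using star_eq_image[of E v] assms by (simp add: card_image)
qed

lemma finite_nbrs:
  assumes "finite E" "\<And>e. e \<in> E \<Longrightarrow> card e = 2"
  shows "finite (nbrs E v)"
proof -
  have "finite {e \<in> E. v \<in> e}" using assms(1) by simp
  then have "finite ((\<lambda>w. {v, w}) ` nbrs E v)" using star_eq_image[of E v] assms(2) by simp
  then show ?thesis by (rule finite_imageD) (auto simp: inj_on_def doubleton_eq_iff)
qed

lemma card_delete_vertex:
  assumes "finite E" "\<And>e. e \<in> E \<Longrightarrow> card e = 2"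
  shows "card {e \<in> E. v \<notin> e} + card (nbrs E v) = card E"
proof -
  have "card E = card ({e \<in> E. v \<notin> e} \<union> {e \<in> E. v \<in> e})" by (rule arg_cong[of _ _ card]) auto
  also have "\<dots> = card {e \<in> E. v \<notin> e} + card {e \<in> E. v \<in> e}"
    using assms(1) by (intro card_Un_disjoint) auto
  finally show ?thesis using card_star[of E v] assms(2) by simp
qed

text \<open>The edge \<open>{u, v}\<close> is counted in both degrees, hence the extra 1.\<close>

lemma card_delete_adjacent_vertices:
  assumes "finite E" "\<And>e. e \<in> E \<Longrightarrow> card e = 2" "{u, v} \<in> E"
  shows "card {e \<in> E. u \<notin> e \<and> v \<notin> e} + card (nbrs E u) + card (nbrs E v) = card E + 1"
proof -
  let ?E = "{e \<in> E. u \<notin> e}"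
  have uv: "u \<noteq> v" using assms(2)[OF assms(3)] by auto
  have "card {e \<in> ?E. v \<notin> e} + card (nbrs ?E v) = card ?E"
    by (rule card_delete_vertex) (use assms in auto)
  moreover have "{e \<in> ?E. v \<notin> e} = {e \<in> E. u \<notin> e \<and> v \<notin> e}" by auto
  moreover have "nbrs ?E v = nbrs E v - {u}" using uv by (auto simp: nbrs_def)
  moreover have "u \<in> nbrs E v" using assms(3) by (simp add: nbrs_def insert_commute)
  moreover have "finite (nbrs E v)" using finite_nbrs assms(1,2) by metis
  ultimately have "card {e \<in> E. u \<notin> e \<and> v \<notin> e} + (card (nbrs E v) - 1) = card ?E" "card (nbrs E v) > 0"
    by (auto simp: card_gt_0_iff)
  then show ?thesis using card_delete_vertex[OF assms(1,2), of u] by simp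
qed

section \<open>The two kinds of deletion\<close>

text \<open>The claim of the induction. For a single dominating vertex and at most
  \<open>4 * n - 2\<close> edges it gives \<open>k < n\<close>.\<close>

definition cover_bounded :: "'a set set \<Rightarrow> 'a set \<Rightarrow> bool" where
  "cover_bounded E S \<longleftrightarrow> (\<exists>k. 4 * k \<le> card E + card S \<and> triangle_cover k E)"

text \<open>Deleting \<open>W\<close> loses at least \<open>card T + 3\<close> edges, while the
  dominating set gives up one element and gains at most \<open>card T\<close>. The sum of both sizes
  thus drops by at least 4, which pays for raising \<open>k\<close> by one; \<open>A\<close> has
  matching number at most 1 and meets every triangle through \<open>W\<close>.\<close>

lemma cover_bounded_delete_vertices:
  assumes IH: "\<And>E' S'. E' \<subset> E \<Longrightarrow> dominates S' E' \<Longrightarrow> cover_bounded E' S'"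
    and c2: "\<And>e. e \<in> E \<Longrightarrow> card e = 2" and dom: "dominates S E"
    and E': "E' = {e \<in> E. e \<inter> W = {}}" and T: "finite T"
    and bd: "\<And>w x. w \<in> W \<Longrightarrow> {w, x} \<in> E \<Longrightarrow> x \<notin> W \<Longrightarrow> x \<in> \<Union>E' \<Longrightarrow> \<exists>t\<in>T. (t, x) \<in> reach E'"
    and cnt: "card E' + card T + 3 \<le> card E"
    and A: "A \<subseteq> E" "\<And>e e'. e \<in> A \<Longrightarrow> e' \<in> A \<Longrightarrow> e \<inter> e' \<noteq> {}"
    and tri: "\<And>x y z. x \<in> W \<Longrightarrow> {x, y} \<in> E \<Longrightarrow> {y, z} \<in> E \<Longrightarrow> {x, z} \<in> E \<Longrightarrow>
      {x, y} \<in> A \<or> {y, z} \<in> A \<or> {x, z} \<in> A"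
  shows "cover_bounded E S"
proof -
  have sub: "E' \<subset> E" using cnt E' by auto
  have "\<exists>t\<in>T. (t, x) \<in> reach E'" if x: "x \<in> \<Union>(E - E')" "x \<in> \<Union>E'" for x
  proof -
    obtain e w where e: "e \<in> E" "x \<in> e" "w \<in> e" "w \<in> W" using x(1) E' by blast
    have xW: "x \<notin> W" using x(2) E' by blast
    then have "e = {w, x}" using c2[OF e(1)] e by (auto simp: card_2_iff)
    then show ?thesis using bd e xW x(2) by blast
  qed
  then obtain S' where S': "dominates S' E'" "card S' + 1 \<le> card S + card T"
    using dominates_subgraph[OF dom sub _ T] c2 by force
  then obtain k where k: "4 * k \<le> card E' + card S'" "triangle_cover k E'"
    using IH[OF sub] unfolding cover_bounded_def by blast
  have "triangle_cover (k + 1) E"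
  proof (rule triangle_cover_extend[OF k(2) _ A(1)])
    show "E' \<subseteq> E" using sub by blast
    show "card M \<le> 1" if "M \<subseteq> A" "pairwise disjnt M" for M
      using card_intersecting_matching A(2) that by metis
    show "{x, y} \<in> E'" if "{x, y} \<in> E - A" "{y, z} \<in> E - A" "{x, z} \<in> E - A" for x y z
      using tri[of x y z] tri[of y x z] that E' by (auto simp: insert_commute)
  qed
  moreover have "4 * (k + 1) \<le> card E + card S" using k(1) S'(2) cnt by simp
  ultimately show ?thesis unfolding cover_bounded_def by blast
qed

text \<open>No triangle is lost, so \<open>k\<close> stays. One edge disappears and the dominating
  set grows by at most 1, as both ends of the edge replace one old element; the bound does not
  increase.\<close>

lemma cover_bounded_delete_edge:
  assumes IH: "\<And>E' S'. E' \<subset> E \<Longrightarrow> dominates S' E' \<Longrightarrow> cover_bounded E' S'"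
    and fin: "finite E" and c2: "\<And>e. e \<in> E \<Longrightarrow> card e = 2" and dom: "dominates S E"
    and xy: "{x, y} \<in> E" and notri: "\<And>z. \<not> ({x, z} \<in> E \<and> {y, z} \<in> E)"
  shows "cover_bounded E S"
proof -
  let ?E' = "E - {{x, y}}"
  have sub: "?E' \<subset> E" using xy by blast
  have "\<exists>t\<in>{x, y}. (t, w) \<in> reach ?E'" if "w \<in> \<Union>(E - ?E')" for w
    using that by auto
  then obtain S' where S': "dominates S' ?E'" "card S' + 1 \<le> card S + card {x, y}"
    using dominates_subgraph[OF dom sub, of "{x, y}"] c2 by force
  then obtain k where k: "4 * k \<le> card ?E' + card S'" "triangle_cover k ?E'"
    using IH[OF sub] unfolding cover_bounded_def by blast
  have "triangle_cover (k + 0) E"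
  proof (rule triangle_cover_extend[OF k(2), where A = "{}"])
    show "{a, b} \<in> ?E'" if "{a, b} \<in> E - {}" "{b, z} \<in> E - {}" "{a, z} \<in> E - {}" for a b z
      using that notri[of z] by (auto simp: doubleton_eq_iff)
  qed auto
  moreover have "card ?E' + 1 = card E" using fin xy by (metis Suc_eq_plus1 card_Suc_Diff1)
  moreover have "card {x, y} = 2" using c2[OF xy] .
  ultimately show ?thesis using k(1) S'(2) unfolding cover_bounded_def
    by (intro exI[of _ k]) auto
qed

section \<open>The induction on the edge set\<close>

text \<open>The set \<open>S\<close> is generalised because deletions replace it. Once every edge is
  in a triangle, the local facts \<open>star\<close> to \<open>closed\<close> each settle one
  configuration, and the degree of a farthest vertex decides which one is used.\<close>

lemma cover_bounded_if_dominates: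
  assumes "finite E" "\<And>e. e \<in> E \<Longrightarrow> card e = 2" "dominates S E"
  shows "cover_bounded E S"
  using assms
proof (induction E arbitrary: S rule: finite_psubset_induct)
  case (psubset E)
  note fin = \<open>finite E\<close> and dom = \<open>dominates S E\<close>
  have c2: "card e = 2" if "e \<in> E" for e using psubset.prems(1) that .
  have IH: "cover_bounded E' S'" if "E' \<subset> E" "dominates S' E'" for E' S'
    using psubset.IH[OF that(1) _ that(2)] c2 that(1) by blast
  note del = cover_bounded_delete_vertices[OF IH c2 dom]
  let ?N = "nbrs E"
  have finN: "finite (?N v)" for v using finite_nbrs fin c2 by metis
  have edge_at: "\<exists>w\<in>?N v. e = {v, w}" if "e \<in> E" "v \<in> e" for e v
  proof -
    have "e \<in> {e \<in> E. v \<in> e}" using that by simp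
    also have "\<dots> = (\<lambda>w. {v, w}) ` ?N v" by (rule star_eq_image) (rule c2)
    finally show ?thesis by blast
  qed
  have irr: "x \<noteq> y" if "{x, y} \<in> E" for x y using c2[OF that] by auto
  show ?case
  proof (cases "\<exists>x y. {x, y} \<in> E \<and> (\<forall>z. \<not> ({x, z} \<in> E \<and> {y, z} \<in> E))")
    case True
    then show ?thesis using cover_bounded_delete_edge[OF IH fin c2 dom] by blast
  next
    case False
    then have tri: "\<exists>z. {x, z} \<in> E \<and> {y, z} \<in> E" if "{x, y} \<in> E" for x y using that by blast
    \<comment> \<open>Deleting a single vertex \<open>v\<close>, with its whole star as the red set:
      enough if all but three of its neighbours suffice to reach the others without
      \<open>v\<close>.\<close>
    have star: ?thesis
      if "finite T" "card T + 3 \<le> card (?N v)"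
        "\<And>x. x \<in> ?N v \<Longrightarrow> \<exists>t\<in>T. (t, x) \<in> reach {e \<in> E. v \<notin> e}" for v T
    proof (rule del[of "{e \<in> E. v \<notin> e}" "{v}" T "{e \<in> E. v \<in> e}"])
      show "card {e \<in> E. v \<notin> e} + card T + 3 \<le> card E"
        using card_delete_vertex[OF fin c2, of v] that(2) by linarith
    qed (use that in \<open>auto simp: nbrs_iff\<close>)
    \<comment> \<open>The neighbours \<open>b\<close>, \<open>u\<close>, \<open>c\<close> of
      \<open>a\<close> form a path. Hence \<open>b\<close> and \<open>c\<close> can be left out of
      \<open>T\<close>, as \<open>u\<close> reaches them; a fourth neighbour \<open>q\<close> is the
      third one to be left out.\<close>
    have path: ?thesis
      if "{a, u} \<in> E" "{a, b} \<in> E" "{a, c} \<in> E" "{u, b} \<in> E" "{u, c} \<in> E" "b \<noteq> c" "card (?N a) \<ge> 4"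
      for a u b c
    proof -
      have "\<not> ?N a \<subseteq> {u, b, c}"
      proof
        assume "?N a \<subseteq> {u, b, c}"
        then have "card (?N a) \<le> card {u, b, c}" by (intro card_mono) auto
        also have "\<dots> \<le> 3" by (simp add: card_insert_if)
        finally show False using that by simp
      qed
      then obtain q where q: "q \<in> ?N a" "q \<notin> {u, b, c}" by blast
      let ?E' = "{e \<in> E. a \<notin> e}" and ?T = "?N a - {b, c, q}"
      have ub: "{u, b} \<in> ?E'" "{u, c} \<in> ?E'" and uT: "u \<in> ?T"
        using that q irr by (auto simp: nbrs_iff)
      have bc: "\<exists>t\<in>?T. (t, x) \<in> reach ?E'" if "x \<in> ?N a - {q}" for x
      proof (cases "x \<in> {b, c}")
        case True
        then have "(u, x) \<in> reach ?E'" using ub by (auto intro: reach_edge)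
        then show ?thesis using uT by blast
      next
        case False
        then have "x \<in> ?T" using that by blast
        then show ?thesis by (rule bexI[rotated]) simp
      qed
      \<comment> \<open>The triangle on \<open>{a, q}\<close> gives a neighbour \<open>r\<close> of
        \<open>a\<close> that reaches \<open>q\<close>. It may be \<open>b\<close> or
        \<open>c\<close>, which is why \<open>bc\<close> covers all of
        \<open>?N a - {q}\<close>.\<close>
      obtain r where r: "{a, r} \<in> E" "{q, r} \<in> E" using tri[of a q] q by (auto simp: nbrs_iff)
      have "a \<noteq> q" "a \<noteq> r" "q \<noteq> r" using irr r q by (auto simp: nbrs_iff)
      then have "r \<in> ?N a - {q}" "{r, q} \<in> ?E'" using r by (auto simp: nbrs_iff insert_commute)
      then have "\<exists>t\<in>?T. (t, r) \<in> reach ?E'" "(r, q) \<in> reach ?E'"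
        by (blast intro: bc, intro reach_edge)
      then have "\<exists>t\<in>?T. (t, q) \<in> reach ?E'" by (blast intro: reach_trans)
      then have "\<exists>t\<in>?T. (t, x) \<in> reach ?E'" if "x \<in> ?N a" for x using that bc by blast
      moreover have "card ?T + 3 \<le> card (?N a)"
      proof -
        have "card {b, c, q} = 3" using q that by auto
        moreover have "{b, c, q} \<subseteq> ?N a" using q that by (auto simp: nbrs_iff)
        ultimately show ?thesis
          using card_Diff_subset[of "{b, c, q}" "?N a"] that by simp
      qed
      ultimately show ?thesis using star[of ?T a] finN by blast
    qed
    \<comment> \<open>Deleting \<open>x\<close> and \<open>y\<close> loses 3 + 3 - 1 = 5 edges, and
      \<open>T = {z, p}\<close> has two elements. A triangle at \<open>x\<close> uses two of
      \<open>y\<close>, \<open>z\<close>, \<open>p\<close>, hence an edge from \<open>x\<close> to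
      \<open>y\<close> or \<open>z\<close>; likewise at \<open>y\<close>. So the triangle on
      \<open>x\<close>, \<open>y\<close>, \<open>z\<close> can be made red.\<close>
    have diamond: ?thesis
      if "?N x = {y, z, p}" "?N y = {x, z, p}" "card (?N x) = 3" "card (?N y) = 3" for x y z p
    proof -
      let ?E' = "{e \<in> E. x \<notin> e \<and> y \<notin> e}"
      have N: "{x, w} \<in> E \<longleftrightarrow> w \<in> {y, z, p}" "{w, x} \<in> E \<longleftrightarrow> w \<in> {y, z, p}"
          "{y, w} \<in> E \<longleftrightarrow> w \<in> {x, z, p}" "{w, y} \<in> E \<longleftrightarrow> w \<in> {x, z, p}" for w
        using that by (auto simp: nbrs_def insert_commute)
      have d: "x \<noteq> y" "x \<noteq> z" "y \<noteq> z" "x \<noteq> p" "y \<noteq> p" "z \<noteq> p"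
        using N irr that(3) by (auto simp: that(1) card_insert_if split: if_splits)
      have yz: "{x, y} \<in> E" "{x, z} \<in> E" "{y, z} \<in> E" using N by auto
      show ?thesis
      proof (rule del[of ?E' "{x, y}" "{z, p}" "{{x, y}, {x, z}, {y, z}}"])
        show "card ?E' + card {z, p} + 3 \<le> card E"
          using card_delete_adjacent_vertices[OF fin c2 yz(1)] that d by simp
        show "\<exists>t\<in>{z, p}. (t, v) \<in> reach ?E'" if "w \<in> {x, y}" "{w, v} \<in> E" "v \<notin> {x, y}" for w v
          using that N reach_refl by auto
        show "{u, v} \<in> {{x, y}, {x, z}, {y, z}} \<or> {v, w} \<in> {{x, y}, {x, z}, {y, z}} \<or>
            {u, w} \<in> {{x, y}, {x, z}, {y, z}}"
          if "u \<in> {x, y}" "{u, v} \<in> E" "{v, w} \<in> E" "{u, w} \<in> E" for u v w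
        proof -
          have "v \<noteq> w" using irr that by blast
          then have "u = x \<and> (v \<in> {y, z} \<or> w \<in> {y, z}) \<or> u = y \<and> (v \<in> {x, z} \<or> w \<in> {x, z})"
            using that N(1)[of v] N(1)[of w] N(3)[of v] N(3)[of w] by auto
          then show ?thesis by (auto simp: doubleton_eq_iff)
        qed
      qed (use yz d in auto)
    qed
    have deg3: ?thesis if x3: "card (?N x) = 3" for x
    proof -
      obtain a b c where abc: "?N x = {a, b, c}" "a \<noteq> b" "a \<noteq> c" "b \<noteq> c"
        using x3 unfolding card_3_iff by blast
      have centre: ?thesis
        if N: "?N x = {a, b, c}" "a \<noteq> b" "a \<noteq> c" "b \<noteq> c" and ab: "{a, b} \<in> E" "{a, c} \<in> E" for a b c
      proof -
        have x: "{x, a} \<in> E" "{x, b} \<in> E" "{x, c} \<in> E" using N by (auto simp: nbrs_def)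
        have sub: "{x, b, c} \<subseteq> ?N a" using ab x by (auto simp: nbrs_iff insert_commute)
        have c3: "card {x, b, c} = 3" using irr x N by auto
        show ?thesis
        proof (cases "card (?N a) \<ge> 4")
          case True
          then show ?thesis using path[of a x b c] ab x N by (simp add: insert_commute)
        next
          case False
          then have "{x, b, c} = ?N a" using sub c3 finN by (intro card_seteq) auto
          then show ?thesis using diamond[of x a b c] N x3 c3 by simp
        qed
      qed
      \<comment> \<open>Each edge at \<open>x\<close> is in a triangle, so none of the three
        neighbours is isolated among them; then one of them is adjacent to both others.\<close>
      have "{a, b} \<in> E \<or> {a, c} \<in> E" "{b, a} \<in> E \<or> {b, c} \<in> E" "{c, a} \<in> E \<or> {c, b} \<in> E"
        using tri[of x a] tri[of x b] tri[of x c] abc irr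
        by (metis insertE insertI1 insertI2 nbrs_iff singletonD)+
      then consider "{a, b} \<in> E" "{a, c} \<in> E" | "{b, a} \<in> E" "{b, c} \<in> E" | "{c, a} \<in> E" "{c, b} \<in> E"
        by (auto simp: insert_commute)
      then show ?thesis
        using centre[of a b c] centre[of b a c] centre[of c a b] abc
        by cases (auto simp: insert_commute)
    qed
    \<comment> \<open>Deleting \<open>y\<close> and \<open>u\<close> loses
      \<open>card (?N y) + 1\<close> edges, and \<open>T\<close> omits two neighbours of
      \<open>y\<close>, namely \<open>u\<close> and some \<open>q\<close>. The only triangle through
      \<open>u\<close> also contains \<open>y\<close>, so the star at \<open>y\<close>
      suffices.\<close>
    have deg2: ?thesis if N: "?N u = {y, z}" "y \<noteq> z" and big: "card (?N y) \<ge> 4" for u y z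
    proof -
      let ?E' = "{e \<in> E. y \<notin> e \<and> u \<notin> e}"
      have Nu: "{u, w} \<in> E \<longleftrightarrow> w \<in> {y, z}" "{w, u} \<in> E \<longleftrightarrow> w \<in> {y, z}" for w
        using N(1) nbrs_iff[of w E u] insert_commute[of w u "{}"] by simp_all
      have yz: "{y, z} \<in> E" using tri[of u y] Nu irr[of y y] by auto
      have d: "u \<noteq> y" "u \<noteq> z" using irr Nu by auto
      have "\<not> ?N y \<subseteq> {u, z}"
      proof
        assume "?N y \<subseteq> {u, z}"
        then have "card (?N y) \<le> card {u, z}" by (intro card_mono) auto
        then show False using big d by simp
      qed
      then obtain q where "q \<in> ?N y" "q \<notin> {u, z}" by blast
      then have q: "{y, q} \<in> E" "q \<noteq> u" "q \<noteq> z" by (simp_all add: nbrs_iff)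
      let ?T = "?N y - {u, q}"
      obtain r where r: "{y, r} \<in> E" "{q, r} \<in> E" using tri[of y q] q by blast
      have d': "q \<noteq> y" "r \<noteq> y" "q \<noteq> r" using irr[OF q(1)] irr[OF r(1)] irr[OF r(2)] by simp_all
      \<comment> \<open>This is where \<open>q \<noteq> z\<close> matters: \<open>q\<close> is not
        adjacent to \<open>u\<close>, so the vertex \<open>r\<close> reaching \<open>q\<close>
        survives the deletion.\<close>
      have "r \<noteq> u" using r(2) Nu(2)[of q] q d'(1) by auto
      have uq: "{u, q} \<subseteq> ?N y" using q(1) Nu(2)[of y] by (simp add: nbrs_iff)
      show ?thesis
      proof (rule del[of ?E' "{y, u}" ?T "{e \<in> E. y \<in> e}"])
        have "card ?T + 2 = card (?N y)"
          using card_Diff_subset[OF _ uq] q big by simp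
        then show "card ?E' + card ?T + 3 \<le> card E"
          using card_delete_adjacent_vertices[OF fin c2, of y u] Nu(2)[of y] N by simp
        show "\<exists>t\<in>?T. (t, x) \<in> reach ?E'" if "w \<in> {y, u}" "{w, x} \<in> E" "x \<notin> {y, u}" for w x
        proof (cases "x = q")
          case True
          have "r \<in> ?T" "{r, q} \<in> ?E'" using r d' q \<open>r \<noteq> u\<close> by (simp_all add: nbrs_iff insert_commute)
          then show ?thesis unfolding True by (intro bexI[of _ r] reach_edge)
        next
          case False
          have "{y, x} \<in> E" using that Nu(1)[of x] yz by auto
          then have "x \<in> ?T" using that(3) False by (simp add: nbrs_iff)
          then show ?thesis by (rule bexI[rotated]) simp
        qed
        show "{x, v} \<in> {e \<in> E. y \<in> e} \<or> {v, w} \<in> {e \<in> E. y \<in> e} \<or> {x, w} \<in> {e \<in> E. y \<in> e}"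
          if "x \<in> {y, u}" "{x, v} \<in> E" "{v, w} \<in> E" "{x, w} \<in> E" for x v w
          using that Nu(1)[of v] Nu(1)[of w] irr[of v w] by auto
      qed (use finN in auto)
    qed
    \<comment> \<open>The component is just a triangle. Deleting \<open>u\<close> and
      \<open>y\<close> loses its three edges and leaves \<open>z\<close> isolated, so
      \<open>T\<close> can be empty and one red edge suffices.\<close>
    have closed: ?thesis if N: "?N u = {y, z}" "y \<noteq> z" "card (?N y) = 2" "card (?N z) = 2" for u y z
    proof -
      let ?E' = "{e \<in> E. u \<notin> e \<and> y \<notin> e}"
      have u: "{u, y} \<in> E" "{u, z} \<in> E" using N by (auto simp: nbrs_def)
      have Nu: "{u, w} \<in> E \<longleftrightarrow> w \<in> {y, z}" for w using N(1) nbrs_iff[of w E u] by simp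
      have yz: "{y, z} \<in> E" using tri[of u y] Nu irr[of y y] by auto
      have d: "u \<noteq> y" "u \<noteq> z" using irr u by auto
      have Ny: "?N y = {u, z}"
        using d N finN u yz by (intro card_seteq[symmetric]) (auto simp: nbrs_iff insert_commute)
      have Nz: "?N z = {u, y}"
        using d N finN u yz by (intro card_seteq[symmetric]) (auto simp: nbrs_iff insert_commute)
      have z: "z \<notin> \<Union>?E'"
      proof
        assume "z \<in> \<Union>?E'"
        then obtain e where e: "e \<in> E" "z \<in> e" "u \<notin> e" "y \<notin> e" by blast
        obtain w where "w \<in> ?N z" "e = {z, w}" using edge_at[OF e(1,2)] ..
        then show False using e Nz by auto
      qed
      show ?thesis
      proof (rule del[of ?E' "{u, y}" "{}" "{{u, y}}"])
        show "card ?E' + card {} + 3 \<le> card E"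
          using card_delete_adjacent_vertices[OF fin c2 u(1)] N by simp
        show "\<exists>t\<in>{}. (t, x) \<in> reach ?E'"
          if "w \<in> {u, y}" "{w, x} \<in> E" "x \<notin> {u, y}" "x \<in> \<Union>?E'" for w x
        proof -
          have "x = z" using that N Ny by (auto simp: nbrs_def)
          then show ?thesis using that z by blast
        qed
        show "{x, v} \<in> {{u, y}} \<or> {v, w} \<in> {{u, y}} \<or> {x, w} \<in> {{u, y}}"
          if "x \<in> {u, y}" "{x, v} \<in> E" "{v, w} \<in> E" "{x, w} \<in> E" for x v w
        proof -
          have "v \<in> ?N x" "w \<in> ?N x" "v \<noteq> w" using that irr[of v w] by (auto simp: nbrs_iff)
          then have "v = y \<or> w = y \<or> v = u \<or> w = u" using that(1) N Ny by auto
          then show ?thesis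
            using that(1) \<open>v \<noteq> w\<close> \<open>v \<in> ?N x\<close> \<open>w \<in> ?N x\<close> N Ny by (auto simp: doubleton_eq_iff)
        qed
      qed (use u in auto)
    qed
    show ?thesis
    proof (cases "E = {}")
      case True
      then show ?thesis
        unfolding cover_bounded_def triangle_cover_def triangle_free_def by (intro exI[of _ 0]) auto
    next
      case False
      then have "\<Union>E \<noteq> {}" using c2 by fastforce
      moreover have "finite (\<Union>E)"
      proof (rule finite_Union[OF fin])
        show "finite e" if "e \<in> E" for e using c2[OF that] card.infinite by fastforce
      qed
      ultimately obtain u where u: "u \<in> \<Union>E" "dominates S {e \<in> E. u \<notin> e}"
        using distance_maximal_not_cut[OF dom] by blast
      have deg_ge2: "card (?N v) \<ge> 2" if v: "v \<in> \<Union>E" for v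
      proof -
        obtain e where e: "e \<in> E" "v \<in> e" using v by blast
        obtain x where "x \<in> ?N v" using edge_at[OF e] ..
        then have x: "{v, x} \<in> E" by (simp add: nbrs_iff)
        obtain y where y: "{v, y} \<in> E" "{x, y} \<in> E" using tri[OF x] by blast
        have "card {x, y} \<le> card (?N v)" using x y finN by (intro card_mono) (auto simp: nbrs_iff)
        then show ?thesis using c2[OF y(2)] by simp
      qed
      consider "card (?N u) = 2" | "card (?N u) = 3" | "card (?N u) \<ge> 4" using deg_ge2[OF u(1)] by linarith
      then show ?thesis
      proof cases
        case 1
        then obtain y z where N: "?N u = {y, z}" "y \<noteq> z" unfolding card_2_iff by blast
        then have "y \<in> \<Union>E" "z \<in> \<Union>E" by (auto simp: nbrs_def)
        then have yz: "card (?N y) \<ge> 2" "card (?N z) \<ge> 2" using deg_ge2 by auto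
        have N': "?N u = {z, y}" using N by auto
        consider "card (?N y) = 3 \<or> card (?N z) = 3" | "card (?N y) \<ge> 4" | "card (?N z) \<ge> 4"
          | "card (?N y) = 2" "card (?N z) = 2" using yz by linarith
        then show ?thesis
          using deg3 deg2[OF N] deg2[OF N' N(2)[symmetric]] closed[OF N] by cases blast+
      next
        case 2
        then show ?thesis by (rule deg3)
      next
        case 3
        \<comment> \<open>Here \<open>S\<close> itself still dominates by the choice of
          \<open>u\<close>, so the drop of 4 comes from the edges alone.\<close>
        let ?E' = "{e \<in> E. u \<notin> e}" and ?A = "{e \<in> E. u \<in> e}"
        have cnt: "card ?E' + card (?N u) = card E" using card_delete_vertex[OF fin c2] by blast
        have "?E' \<subset> E" using u(1) by blast
        then obtain k where k: "4 * k \<le> card ?E' + card S" "triangle_cover k ?E'"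
          using IH u(2) unfolding cover_bounded_def by blast
        have "triangle_cover (k + 1) E"
        proof (rule triangle_cover_extend[OF k(2), where A = ?A])
          show "card M \<le> 1" if "M \<subseteq> ?A" "pairwise disjnt M" for M
            by (rule card_intersecting_matching[OF _ that]) auto
        qed auto
        moreover have "4 * (k + 1) \<le> card E + card S" using k(1) cnt 3 by simp
        ultimately show ?thesis unfolding cover_bounded_def by blast
      qed
    qed
  qed
qed

section \<open>The lower bound\<close>

text \<open>With at most \<open>4 * n - 2\<close> edges, any single vertex as dominating set yields
  a triangle cover of matching number below \<open>n\<close>. With the cover red and the rest blue,
  neither a red matching of \<open>n\<close> edges nor a blue triangle exists.\<close>

lemma edges_ge_if_arrows:
  fixes G :: "'a ugraph"
  assumes G: "simple_graph G" "connected_graph G"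
    and arr: "arrows G (matching_graph n) triangle_graph"
  shows "4 * n - 1 \<le> card (edges G)"
proof (rule ccontr)
  assume "\<not> ?thesis"
  then have m: "card (edges G) + 1 < 4 * n" by linarith
  let ?E = "edges G"
  have c2: "card e = 2" "e \<subseteq> vertices G" if "e \<in> ?E" for e
    using G that by (auto simp: simple_graph_def)
  have fin: "finite ?E"
    using c2(2) G(1) by (intro finite_subset[of ?E "Pow (vertices G)"]) (auto simp: simple_graph_def)
  obtain s where "s \<in> vertices G" using G by (auto simp: connected_graph_def)
  then have "dominates {s} ?E"
    using G(2) c2(2) unfolding dominates_def connected_graph_def reach_def by blast
  then obtain k where k: "4 * k \<le> card ?E + card {s}" "triangle_cover k ?E"
    using cover_bounded_if_dominates[OF fin c2(1)] unfolding cover_bounded_def by blast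
  then have "k < n" using m by simp
  obtain F where F: "F \<subseteq> ?E" "triangle_free (?E - F)"
      "\<And>M. M \<subseteq> F \<Longrightarrow> pairwise disjnt M \<Longrightarrow> card M \<le> k"
    using k unfolding triangle_cover_def by blast
  define c where "c e = (if e \<in> F then Red else Blue)" for e
  have "contains_copy (colour_class G c Red) (matching_graph n) \<or>
      contains_copy (colour_class G c Blue) triangle_graph"
    using arr by (simp add: arrows_def)
  then show False
  proof
    assume "contains_copy (colour_class G c Red) (matching_graph n)"
    then obtain f where f: "inj_on f {0..<2 * n}"
        "\<And>e. e \<in> edges (matching_graph n) \<Longrightarrow> f ` e \<in> edges (colour_class G c Red)"
      by (auto simp: contains_copy_def matching_graph_def)
    have red: "f ` {2 * i, 2 * i + 1} \<in> F" if "i < n" for i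
    proof -
      have "{2 * i, 2 * i + 1} \<in> edges (matching_graph n)" using that by (auto simp: matching_graph_def)
      from f(2)[OF this] show ?thesis by (simp add: colour_class_def c_def split: if_splits)
    qed
    \<comment> \<open>The images of the matching edges; being disjoint and nonempty they are
      distinct, so they form \<open>n\<close> disjoint edges of \<open>F\<close>.\<close>
    define g where "g i = f ` {2 * i, 2 * i + 1}" for i
    have dj: "g i \<inter> g j = {}" if "i < n" "j < n" "i \<noteq> j" for i j
    proof -
      have "g i \<inter> g j = f ` ({2 * i, 2 * i + 1} \<inter> {2 * j, 2 * j + 1})"
        unfolding g_def using that by (intro inj_on_image_Int[OF f(1), symmetric]) auto
      also have "{2 * i, 2 * i + 1} \<inter> {2 * j, 2 * j + 1} = {}" using that by auto
      finally show ?thesis by simp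
    qed
    have "inj_on g {..<n}"
    proof (rule inj_onI, rule ccontr)
      fix i j assume "i \<in> {..<n}" "j \<in> {..<n}" "g i = g j" "i \<noteq> j"
      then have "g i = {}" using dj[of i j] by auto
      then show False by (simp add: g_def)
    qed
    then have "card (g ` {..<n}) = n" by (simp add: card_image)
    moreover have "card (g ` {..<n}) \<le> k"
      by (rule F(3)) (use red dj in \<open>auto simp: g_def pairwise_def disjnt_def\<close>)
    ultimately show False using \<open>k < n\<close> by simp
  next
    assume "contains_copy (colour_class G c Blue) triangle_graph"
    then obtain f :: "nat \<Rightarrow> 'a" where "\<forall>e\<in>edges triangle_graph. f ` e \<in> edges (colour_class G c Blue)"
      unfolding contains_copy_def by blast
    then have "f ` {0, 1} \<in> ?E - F" "f ` {1, 2} \<in> ?E - F" "f ` {0, 2} \<in> ?E - F"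
      by (auto simp: colour_class_def triangle_graph_def c_def split: if_splits)
    then show False using F(2) unfolding triangle_free_def by auto
  qed
qed

section \<open>The extremal graph\<close>

text \<open>Triangle \<open>i\<close> occupies the numbers with quotient \<open>i\<close> modulo 3,
  and its first vertex is joined to that of the next triangle.\<close>

definition triangle_chain :: "nat \<Rightarrow> nat ugraph" where
  "triangle_chain n = ({0..<3 * n},
     (\<lambda>i. {3 * i, 3 * i + 1}) ` {..<n} \<union> (\<lambda>i. {3 * i + 1, 3 * i + 2}) ` {..<n} \<union>
     (\<lambda>i. {3 * i, 3 * i + 2}) ` {..<n} \<union> (\<lambda>i. {3 * i, 3 * i + 3}) ` {..<n - 1})"

lemma simple_triangle_chain: "simple_graph (triangle_chain n)"
  by (auto simp: simple_graph_def triangle_chain_def)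

text \<open>An upper estimate suffices: the reverse inequality will come from the lower bound
  applied to the chain itself.\<close>

lemma card_triangle_chain_le:
  assumes "n > 0"
  shows "card (edges (triangle_chain n)) \<le> 4 * n - 1"
proof -
  have le: "card (f ` {..<m}) \<le> m" for f :: "nat \<Rightarrow> nat set" and m
    using card_image_le[of "{..<m}" f] by simp
  have un: "card (A \<union> B) \<le> a + b" if "card A \<le> a" "card B \<le> b" for A B :: "nat set set" and a b
    using card_Un_le[of A B] that by linarith
  have "card (edges (triangle_chain n)) \<le> n + n + n + (n - 1)"
    unfolding triangle_chain_def snd_conv by (intro un le)
  then show ?thesis using assms by linarith
qed

lemma connected_triangle_chain:
  assumes "n > 0"
  shows "connected_graph (triangle_chain n)"
proof -
  let ?E = "edges (triangle_chain n)"
  have 0: "(0, 3 * i) \<in> reach ?E" if "i < n" for i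
    using that
  proof (induction i)
    case (Suc i)
    have "i \<in> {..<n - 1}" using Suc.prems by auto
    then have "{3 * i, 3 * i + 3} \<in> ?E" by (auto simp: triangle_chain_def)
    then have "(3 * i, 3 * i + 3) \<in> reach ?E" by (rule reach_edge)
    moreover have "3 * Suc i = 3 * i + 3" by simp
    ultimately show ?case using Suc reach_trans by (metis Suc_lessD)
  qed simp
  have all: "(0, v) \<in> reach ?E" if "v < 3 * n" for v
  proof -
    define i where "i = v div 3"
    have i: "i < n" using that by (auto simp: i_def)
    have "{3 * i, 3 * i + 1} \<in> ?E" "{3 * i, 3 * i + 2} \<in> ?E"
      using i by (auto simp: triangle_chain_def)
    then have "(3 * i, 3 * i + 1) \<in> reach ?E" "(3 * i, 3 * i + 2) \<in> reach ?E"
      by (auto intro: reach_edge)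
    moreover have "v = 3 * i \<or> v = 3 * i + 1 \<or> v = 3 * i + 2" unfolding i_def by presburger
    ultimately show ?thesis using 0[OF i] reach_trans by metis
  qed
  have "(u, v) \<in> reach ?E" if "u < 3 * n" "v < 3 * n" for u v
    using all that reach_sym reach_trans by metis
  then show ?thesis
    using assms by (auto simp: connected_graph_def reach_def triangle_chain_def)
qed

text \<open>Without a blue triangle, each of the \<open>n\<close> vertex-disjoint triangles has a
  red edge, and these edges form a matching.\<close>

lemma arrows_triangle_chain: "arrows (triangle_chain n) (matching_graph n) triangle_graph"
  unfolding arrows_def
proof (intro allI disjCI)
  fix c
  let ?E = "edges (triangle_chain n)"
  assume blue: "\<not> contains_copy (colour_class (triangle_chain n) c Blue) triangle_graph"
  \<comment> \<open>The quotient by 3 tells the triangle of a vertex, so asking for equal quotients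
    excludes the linking edges.\<close>
  have "\<exists>a b. a \<noteq> b \<and> a div 3 = i \<and> b div 3 = i \<and> {a, b} \<in> ?E \<and> c {a, b} = Red" if "i < n" for i
  proof (rule ccontr)
    assume none: "\<not> ?thesis"
    have E: "{3 * i, 3 * i + 1} \<in> ?E" "{3 * i + 1, 3 * i + 2} \<in> ?E" "{3 * i, 3 * i + 2} \<in> ?E"
      using that by (auto simp: triangle_chain_def)
    have only_blue: "c {a, b} = Blue" if "a \<noteq> b" "a div 3 = i" "b div 3 = i" "{a, b} \<in> ?E" for a b
      using none that by (cases "c {a, b}") blast+
    have B: "c {3 * i, 3 * i + 1} = Blue" "c {3 * i + 1, 3 * i + 2} = Blue" "c {3 * i, 3 * i + 2} = Blue"
      using only_blue[OF _ _ _ E(1)] only_blue[OF _ _ _ E(2)] only_blue[OF _ _ _ E(3)] by simp_all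
    have "contains_copy (colour_class (triangle_chain n) c Blue) triangle_graph"
      unfolding contains_copy_def
    proof (intro exI conjI)
      show "inj_on (\<lambda>j. 3 * i + j) (vertices triangle_graph)" by (auto simp: inj_on_def)
      show "(\<lambda>j. 3 * i + j) ` vertices triangle_graph \<subseteq> vertices (colour_class (triangle_chain n) c Blue)"
        using that by (auto simp: triangle_graph_def colour_class_def triangle_chain_def)
      show "\<forall>e\<in>edges triangle_graph.
          (\<lambda>j. 3 * i + j) ` e \<in> edges (colour_class (triangle_chain n) c Blue)"
        using E B by (auto simp: triangle_graph_def colour_class_def)
    qed
    then show False using blue by blast
  qed
  then obtain a b where ab: "\<And>i. i < n \<Longrightarrow> a i \<noteq> b i \<and> a i div 3 = i \<and> b i div 3 = i \<and>
      {a i, b i} \<in> ?E \<and> c {a i, b i} = Red"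
    by metis
  \<comment> \<open>The matching edge on \<open>2 * i\<close> and \<open>2 * i + 1\<close> goes to
    the red edge of triangle \<open>i\<close>. Quotients separate different triangles, parity the
    two ends of one edge.\<close>
  define f where "f j = (if even j then a (j div 2) else b (j div 2))" for j :: nat
  have f3: "f j div 3 = j div 2" if "j < 2 * n" for j
    using ab[of "j div 2"] that by (auto simp: f_def)
  show "contains_copy (colour_class (triangle_chain n) c Red) (matching_graph n)"
    unfolding contains_copy_def
  proof (intro exI conjI)
    show "inj_on f (vertices (matching_graph n))"
    proof (rule inj_onI)
      fix i j assume ij: "i \<in> vertices (matching_graph n)" "j \<in> vertices (matching_graph n)" "f i = f j"
      then have lt: "i < 2 * n" "j < 2 * n" by (auto simp: matching_graph_def)
      then have "i div 2 = j div 2" using f3 ij(3) by metis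
      moreover have "even i \<longleftrightarrow> even j"
        using ij(3) ab[of "j div 2"] lt calculation by (auto simp: f_def split: if_splits)
      ultimately show "i = j" by presburger
    qed
    show "f ` vertices (matching_graph n) \<subseteq> vertices (colour_class (triangle_chain n) c Red)"
    proof clarify
      fix j assume "j \<in> vertices (matching_graph n)"
      then have j: "j < 2 * n" by (simp add: matching_graph_def)
      then have "f j div 3 < n" using f3[OF j] by simp
      then have "f j < 3 * n" by simp
      then show "f j \<in> vertices (colour_class (triangle_chain n) c Red)"
        by (simp add: colour_class_def triangle_chain_def)
    qed
    show "\<forall>e\<in>edges (matching_graph n). f ` e \<in> edges (colour_class (triangle_chain n) c Red)"
      using ab by (auto simp: matching_graph_def colour_class_def f_def insert_commute)
  qed
qed

theorem theorem4:
  fixes n :: nat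
  assumes "n > 0"
  shows "connected_size_ramsey (matching_graph n) triangle_graph = 4 * n - 1"
  unfolding connected_size_ramsey_def
proof (rule Least_equality)
  let ?G = "triangle_chain n"
  have "card (edges ?G) = 4 * n - 1"
    using edges_ge_if_arrows[OF simple_triangle_chain connected_triangle_chain[OF assms]
        arrows_triangle_chain] card_triangle_chain_le assms by (intro antisym) auto
  then show "\<exists>G :: nat ugraph. simple_graph G \<and> connected_graph G \<and>
      arrows G (matching_graph n) triangle_graph \<and> card (edges G) = 4 * n - 1"
    using simple_triangle_chain connected_triangle_chain[OF assms] arrows_triangle_chain by blast
qed (use edges_ge_if_arrows assms in blast)

end
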